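(* The discrete Ricci curvature of the Hasse diagrams of the Bruhat orders of the dihedral groups satisfies $$\mathrm{Ric}(H(I_2(3)))=\frac{21-\sqrt{33}}{12},\qquad \mathrm{Ric}(H(I_2(4)))=\frac12,\qquad \mathrm{Ric}(H(I_2(5)))=\frac{5-\sqrt{17}}{4},$$ and $\mathrm{Ric}(H(I_2(n)))=0$ for every integer $n>5$.
   Context: Ricci curvature. Let $G$ be a simple undirected graph (no loops, no multiple edges) that is locally finite and has no isolated vertices, with vertex set $\mathcal V(G)$; $B(1,x)$ is the set of neighbours of $x$. For real functions $f,g$ on $\mathcal V(G)$ and $x\in\mathcal V(G)$ put $\Delta(f)(x)=\sum_{v\in B(1,x)}(f(v)-f(x))$, $\Gamma(f,g)(x)=\frac12\sum_{v\in B(1,x)}(f(x)-f(v))(g(x)-g(v))$, $\Gamma(f)=\Gamma(f,f)$, and $\Gamma_2(f)(x)=\frac12\Delta(\Gamma(f,f))(x)-\Gamma(f,\Delta(f))(x)$. The discrete Ricci curvature $\mathrm{Ric}(G)$ is the maximum $K\in\mathbb R\cup\{-\infty\}$ such that $\Gamma_2(f)(x)\ge K\,\Gamma(f)(x)$ for every real function $f$ on $\mathcal V(G)$ and every vertex $x$. Bruhat order. For a Coxeter system $(W,S)$, $\ell$ is the length function with respect to $S$ and $T=\bigcup_{w\in W}wSw^{-1}$. The Bruhat order on $W$ is the partial order generated by the relations $tw<w$ for $w\in W$, $t\in T$ with $\ell(tw)<\ell(w)$. $H(W)$ is the undirected graph with vertex set $W$ in which two elements are joined by an edge iff one covers the other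 in the Bruhat order. $I_2(m)$ is the dihedral group of order $2m$, with Coxeter generators $s,t$ subject to $s^2=t^2=(st)^m=e$. *)

theory Defs
  imports Complex_Main "HOL-Library.Extended_Real" "HOL-Algebra.Generated_Groups"
begin

text \<open>
  Edges are unordered pairs, that is, two-element sets of vertices. The operators below are meant
  for locally finite simple graphs without isolated vertices; they inspect a function only at
  vertices, so functions on the vertex set are represented by total functions on the vertex type.
\<close>

record 'a ugraph =
  verts :: "'a set"
  edges :: "'a set set"

definition neighbours :: "'a ugraph \<Rightarrow> 'a \<Rightarrow> 'a set" where
  "neighbours G x = {v \<in> verts G. {x, v} \<in> edges G}"

definition laplacian :: "'a ugraph \<Rightarrow> ('a \<Rightarrow> real) \<Rightarrow> 'a \<Rightarrow> real" where
  "laplacian G f x = (\<Sum>v\<in>neighbours G x. f v - f x)"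

definition Gamma1 :: "'a ugraph \<Rightarrow> ('a \<Rightarrow> real) \<Rightarrow> ('a \<Rightarrow> real) \<Rightarrow> 'a \<Rightarrow> real" where
  "Gamma1 G f g x = 1/2 * (\<Sum>v\<in>neighbours G x. (f x - f v) * (g x - g v))"

definition Gamma2 :: "'a ugraph \<Rightarrow> ('a \<Rightarrow> real) \<Rightarrow> 'a \<Rightarrow> real" where
  "Gamma2 G f x = 1/2 * laplacian G (Gamma1 G f f) x - Gamma1 G f (laplacian G f) x"

definition curvature_bound :: "'a ugraph \<Rightarrow> real \<Rightarrow> bool" where
  "curvature_bound G k \<longleftrightarrow> (\<forall>f. \<forall>x\<in>verts G. Gamma2 G f x \<ge> k * Gamma1 G f f x)"

text \<open>The maximum over \<open>\<real> \<union> {-\<infinity>}\<close>; the bound \<open>-\<infinity>\<close> holds for every graph.\<close>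

definition Ric :: "'a ugraph \<Rightarrow> ereal" where
  "Ric G = (GREATEST K. K = -\<infinity> \<or> (\<exists>k. K = ereal k \<and> curvature_bound G k))"

definition word_prod :: "('a, 'b) monoid_scheme \<Rightarrow> 'a list \<Rightarrow> 'a" where
  "word_prod W ws = foldr (\<lambda>x y. x \<otimes>\<^bsub>W\<^esub> y) ws \<one>\<^bsub>W\<^esub>"

definition word_length :: "('a, 'b) monoid_scheme \<Rightarrow> 'a set \<Rightarrow> 'a \<Rightarrow> nat" where
  "word_length W S w = (LEAST k. \<exists>ws. set ws \<subseteq> S \<and> length ws = k \<and> word_prod W ws = w)"

definition reflections :: "('a, 'b) monoid_scheme \<Rightarrow> 'a set \<Rightarrow> 'a set" where
  "reflections W S = (\<Union>w\<in>carrier W. {w \<otimes>\<^bsub>W\<^esub> s \<otimes>\<^bsub>W\<^esub> inv\<^bsub>W\<^esub> w | s. s \<in> S})"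

definition bruhat_step :: "('a, 'b) monoid_scheme \<Rightarrow> 'a set \<Rightarrow> ('a \<times> 'a) set" where
  "bruhat_step W S = {(t \<otimes>\<^bsub>W\<^esub> w, w) | t w. t \<in> reflections W S \<and> w \<in> carrier W \<and>
     word_length W S (t \<otimes>\<^bsub>W\<^esub> w) < word_length W S w}"

text \<open>
  Every generating relation increases the length, so the transitive closure is irreflexive and is
  the strict part of the partial order generated by these relations.
\<close>

definition bruhat_less :: "('a, 'b) monoid_scheme \<Rightarrow> 'a set \<Rightarrow> ('a \<times> 'a) set" where
  "bruhat_less W S = (bruhat_step W S)\<^sup>+"

definition bruhat_covers :: "('a, 'b) monoid_scheme \<Rightarrow> 'a set \<Rightarrow> 'a \<Rightarrow> 'a \<Rightarrow> bool" where
  "bruhat_covers W S y x \<longleftrightarrow> (x, y) \<in> bruhat_less W S \<and>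
     \<not> (\<exists>z. (x, z) \<in> bruhat_less W S \<and> (z, y) \<in> bruhat_less W S)"

definition bruhat_graph :: "('a, 'b) monoid_scheme \<Rightarrow> 'a set \<Rightarrow> 'a ugraph" where
  "bruhat_graph W S = \<lparr>verts = carrier W,
     edges = {{x, y} | x y. x \<in> carrier W \<and> y \<in> carrier W \<and> bruhat_covers W S y x}\<rparr>"

text \<open>
  A group generated by \<open>s\<close> and \<open>t\<close> that satisfies the relations is a quotient of the group of order
  \<open>2 * m\<close> presented by them, so the condition on the order says that there are no further relations.
\<close>

locale dihedral_system = group W for W (structure) +
  fixes s t :: 'a and m :: nat
  assumes s_closed: "s \<in> carrier W"
    and t_closed: "t \<in> carrier W"
    and generated: "generate W {s, t} = carrier W"
    and s_square: "s \<otimes> s = \<one>"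
    and t_square: "t \<otimes> t = \<one>"
    and st_pow: "(s \<otimes> t) [^] m = \<one>"
    and order_W: "order W = 2 * m"

text \<open>A model for every \<open>m > 0\<close>: the pair \<open>(k, b)\<close> stands for \<open>(s t)\<^sup>k t\<^sup>b\<close>.\<close>

definition dihedral_model :: "nat \<Rightarrow> (int \<times> bool) monoid" where
  "dihedral_model m = \<lparr>carrier = {0..<int m} \<times> UNIV,
     mult = (\<lambda>(a, b) (c, d). ((a + (if b then - c else c)) mod int m, b \<noteq> d)),
     one = (0, False)\<rparr>"

lemma dihedral_model_pow:
  "([^]\<^bsub>dihedral_model m\<^esub>) (1 mod int m, False) k = (int k mod int m, False)"
proof (induction k)
  case 0
  then show ?case by (simp add: nat_pow_def dihedral_model_def)
next
  case (Suc k)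
  then show ?case
    by (simp add: nat_pow_def dihedral_model_def mod_simps ac_simps)
qed

lemma group_dihedral_model:
  assumes "m > 0"
  shows "group (dihedral_model m)"
proof (rule groupI)
  fix x assume "x \<in> carrier (dihedral_model m)"
  then obtain a b where x: "x = (a, b)" "0 \<le> a" "a < int m"
    by (auto simp: dihedral_model_def)
  show "\<exists>y\<in>carrier (dihedral_model m). y \<otimes>\<^bsub>dihedral_model m\<^esub> x = \<one>\<^bsub>dihedral_model m\<^esub>"
    using x assms
    by (intro bexI[of _ "(if b then a else (- a) mod int m, b)"])
      (auto simp: dihedral_model_def mod_simps)
qed (use assms in \<open>auto simp: dihedral_model_def mod_simps algebra_simps split: if_splits\<close>)

lemma dihedral_system_model:
  assumes "m > 0"
  shows "dihedral_system (dihedral_model m) (1 mod int m, True) (0, True) m"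
proof -
  let ?W = "dihedral_model m" and ?s = "(1 mod int m, True)" and ?t = "(0 :: int, True)"
  interpret W: group ?W by (rule group_dihedral_model[OF assms])
  have st: "?s \<otimes>\<^bsub>?W\<^esub> ?t = (1 mod int m, False)"
    by (simp add: dihedral_model_def)
  have pow: "(?s \<otimes>\<^bsub>?W\<^esub> ?t) [^]\<^bsub>?W\<^esub> k = (int k mod int m, False)" for k :: nat
    unfolding st by (rule dihedral_model_pow)
  have closed: "?s \<in> carrier ?W" "?t \<in> carrier ?W"
    using assms by (auto simp: dihedral_model_def)
  have pow_gen: "(?s \<otimes>\<^bsub>?W\<^esub> ?t) [^]\<^bsub>?W\<^esub> k \<in> generate ?W {?s, ?t}" for k :: nat
    by (induction k) (auto intro: generate.one generate.eng generate.incl)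
  have "carrier ?W \<subseteq> generate ?W {?s, ?t}"
  proof
    fix x assume "x \<in> carrier ?W"
    then obtain a b where x: "x = (a, b)" "0 \<le> a" "a < int m"
      by (auto simp: dihedral_model_def)
    have a: "(a, False) \<in> generate ?W {?s, ?t}"
      using pow_gen[of "nat a"] x by (simp add: pow)
    have "(a, False) \<otimes>\<^bsub>?W\<^esub> ?t \<in> generate ?W {?s, ?t}"
      by (intro generate.eng a generate.incl) simp
    then have "(a, True) \<in> generate ?W {?s, ?t}"
      using x by (simp add: dihedral_model_def)
    with a show "x \<in> generate ?W {?s, ?t}"
      using x by (cases b) auto
  qed
  then have gen: "generate ?W {?s, ?t} = carrier ?W"
    using W.generate_incl[of "{?s, ?t}"] closed by auto
  show ?thesis
  proof unfold_locales
    show "order ?W = 2 * m"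
      by (simp add: order_def dihedral_model_def card_cartesian_product)
    show "(?s \<otimes>\<^bsub>?W\<^esub> ?t) [^]\<^bsub>?W\<^esub> m = \<one>\<^bsub>?W\<^esub>"
      unfolding pow by (simp add: dihedral_model_def)
  qed (use closed gen in \<open>auto simp: dihedral_model_def\<close>)
qed

end

theory Submission
  imports Defs
begin

text \<open>
  The elements of the dihedral group of order \<open>2 n\<close> are the alternating words in \<open>s\<close> and \<open>t\<close>: one of
  length \<open>0\<close>, two of every length strictly between \<open>0\<close> and \<open>n\<close>, and one of length \<open>n\<close>. Any two
  elements of consecutive lengths differ by a reflection, so the Bruhat order is just the order by
  length, and its Hasse diagram consists of levels of sizes \<open>1, 2, \<dots>, 2, 1\<close> with all edges
  between consecutive levels. This is \<open>bruhat_graph_levels\<close>; everything else is about such graphs.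

  At a vertex \<open>x\<close>, normalised by \<open>f x = 0\<close>, the form \<open>\<Gamma>\<^sub>2\<close> depends on the values of \<open>f\<close> at distance at
  most two, and the values at distance two occur in separate squares. Completing these squares
  (\<open>Gamma_bottom\<close>, \<open>Gamma_atom\<close>, \<open>Gamma_interior\<close>) leaves a quadratic form in the at most four
  differences of \<open>f\<close> along the edges at \<open>x\<close>, the variables of \<open>\<Gamma>\<close>. It depends only on the sizes of
  the levels within distance two of \<open>x\<close>, and it splits further into the squares of the differences
  inside a level and a form in the sums over the levels above and below \<open>x\<close>.

  At the two extreme vertices the best local bound is at least \<open>3/2\<close>, more than at some other
  vertex. For \<open>n = 3\<close> the minimum is attained at lengths \<open>1\<close> and \<open>2\<close>, for \<open>n = 4\<close> at length \<open>2\<close>,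
  for \<open>n = 5\<close> at lengths \<open>2\<close> and \<open>3\<close>; the irrational values are the smaller roots of the
  discriminant of the binary form in the two sums, and a null vector of that form gives a function
  with equality. For \<open>n > 5\<close> all local forms are nonnegative, and around an element of length \<open>3\<close> the
  length function is harmonic with constant \<open>\<Gamma>\<close>, hence has \<open>\<Gamma>\<^sub>2 = 0\<close>. The inversion of the order,
  \<open>l \<mapsto> n - l\<close>, halves the number of cases.
\<close>

section \<open>Curvature from local inequalities\<close>

text \<open>
  A function with equality and positive \<open>\<Gamma>\<close> at a single vertex makes a curvature bound sharp.
\<close>

lemma Ric_eqI:
  assumes "curvature_bound G k" "x \<in> verts G"
    and "Gamma2 G f x = k * Gamma1 G f f x" "Gamma1 G f f x > 0"
  shows "Ric G = ereal k"
  unfolding Ric_def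
proof (rule Greatest_equality)
  show "ereal k = -\<infinity> \<or> (\<exists>k'. ereal k = ereal k' \<and> curvature_bound G k')"
    using assms(1) by blast
next
  fix K assume "K = -\<infinity> \<or> (\<exists>k'. K = ereal k' \<and> curvature_bound G k')"
  then consider "K = -\<infinity>" | k' where "K = ereal k'" "curvature_bound G k'"
    by blast
  then show "K \<le> ereal k"
  proof cases
    case (2 k')
    then have "k' * Gamma1 G f f x \<le> k * Gamma1 G f f x"
      using assms(2,3) unfolding curvature_bound_def by metis
    then show ?thesis using assms(4) 2(1) by simp
  qed simp
qed

text \<open>
  A path \<open>x, v, u\<close> contributes the square of the second difference
  \<open>f u - 2 f v + f x = g u - 2 g v\<close>. In this form each vertex \<open>u\<close> at distance two can be
  eliminated by completing squares.
\<close>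

lemma four_Gamma2:
  fixes f :: "'a \<Rightarrow> real"
  defines "g \<equiv> \<lambda>x v. f v - f x"
  shows "4 * Gamma2 G f x =
    (\<Sum>v\<in>neighbours G x. \<Sum>u\<in>neighbours G v. (g x u - 2 * g x v)\<^sup>2 - (g x v)\<^sup>2)
    - real (card (neighbours G x)) * (\<Sum>v\<in>neighbours G x. (g x v)\<^sup>2)
    + 2 * (\<Sum>v\<in>neighbours G x. g x v)\<^sup>2"
proof -
  let ?N = "neighbours G x"
  define Q where "Q = (\<Sum>v\<in>?N. (g x v)\<^sup>2)"
  define S where "S = (\<Sum>v\<in>?N. g x v)"
  have G1x: "Gamma1 G f f x = Q / 2"
    by (simp add: Gamma1_def Q_def g_def power2_eq_square algebra_simps)
  have Lx: "laplacian G f x = S"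
    by (simp add: laplacian_def S_def g_def)
  have "4 * (1/2 * laplacian G (Gamma1 G f f) x) =
      (\<Sum>v\<in>?N. \<Sum>u\<in>neighbours G v. (g x v - g x u)\<^sup>2) - real (card ?N) * Q"
    unfolding laplacian_def sum_subtractf G1x
    by (simp add: Gamma1_def power2_eq_square g_def flip: sum_distrib_left sum_divide_distrib)
  moreover have "4 * Gamma2 G f x =
      4 * (1/2 * laplacian G (Gamma1 G f f) x) - 4 * Gamma1 G f (laplacian G f) x"
    unfolding Gamma2_def by (simp only: right_diff_distrib)
  moreover have "4 * Gamma1 G f (laplacian G f) x =
      (\<Sum>v\<in>?N. 2 * g x v * laplacian G f v) - (\<Sum>v\<in>?N. 2 * g x v * S)"
    unfolding Gamma1_def Lx sum_subtractf[symmetric]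
    by (simp add: sum_distrib_left g_def algebra_simps)
  moreover have "(\<Sum>v\<in>?N. 2 * g x v * S) = 2 * S\<^sup>2"
    by (simp add: S_def sum_distrib_left sum_distrib_right power2_eq_square algebra_simps)
  moreover have "(\<Sum>v\<in>?N. 2 * g x v * laplacian G f v) =
      (\<Sum>v\<in>?N. \<Sum>u\<in>neighbours G v. 2 * g x v * (g x u - g x v))"
    by (simp add: laplacian_def sum_distrib_left g_def)
  moreover have "(\<Sum>v\<in>?N. \<Sum>u\<in>neighbours G v. (g x v - g x u)\<^sup>2) -
      (\<Sum>v\<in>?N. \<Sum>u\<in>neighbours G v. 2 * g x v * (g x u - g x v)) =
      (\<Sum>v\<in>?N. \<Sum>u\<in>neighbours G v. (g x u - 2 * g x v)\<^sup>2 - (g x v)\<^sup>2)"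
    unfolding sum_subtractf[symmetric]
    by (intro sum.cong refl) (simp add: power2_eq_square algebra_simps)
  ultimately show ?thesis
    unfolding Q_def[symmetric] S_def[symmetric] by simp
qed

lemma four_Gamma1:
  "4 * Gamma1 G f f x = 2 * (\<Sum>v\<in>neighbours G x. (f v - f x)\<^sup>2)"
  by (simp add: Gamma1_def power2_eq_square algebra_simps)

lemma Gamma1_nonneg: "Gamma1 G f f x \<ge> 0"
  using four_Gamma1[of G f x] sum_nonneg[of "neighbours G x" "\<lambda>v. (f v - f x)\<^sup>2"] by simp

lemma le_of_eq_add_nonneg:
  fixes a :: real
  shows "a = b + c + d \<Longrightarrow> c \<ge> 0 \<Longrightarrow> d \<ge> 0 \<Longrightarrow> b \<le> a"
  by simp

text \<open>
  The degenerate case of a binary form suffices: at the optimal curvature bound the discriminant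
  vanishes.
\<close>

lemma binary_form_nonneg:
  fixes a b c x y :: real
  assumes "a > 0" "a * c = b\<^sup>2"
  shows "a * x\<^sup>2 + 2 * b * x * y + c * y\<^sup>2 \<ge> 0"
proof -
  have "a * (a * x\<^sup>2 + 2 * b * x * y + c * y\<^sup>2) = (a * x + b * y)\<^sup>2"
    using assms(2) by algebra
  then show ?thesis
    using assms(1) by (metis zero_le_mult_iff zero_le_power2 not_le)
qed

section \<open>Graphs with small complete levels\<close>

text \<open>
  Ranks are integers, not natural numbers, so that the levels below \<open>0\<close> and above \<open>n\<close> exist and are
  empty: the neighbours of a vertex then form the two adjacent levels without exception.
\<close>

locale two_element_levels =
  fixes G :: "'a ugraph" and rk :: "'a \<Rightarrow> int" and n :: int
  assumes neighbours_eq: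
      "x \<in> verts G \<Longrightarrow> neighbours G x = {v \<in> verts G. \<bar>rk v - rk x\<bar> = 1}"
    and rank_bounds: "x \<in> verts G \<Longrightarrow> 0 \<le> rk x \<and> rk x \<le> n"
    and card_bottom: "card {v \<in> verts G. rk v = 0} = 1"
    and card_top: "card {v \<in> verts G. rk v = n} = 1"
    and card_middle: "0 < i \<Longrightarrow> i < n \<Longrightarrow> card {v \<in> verts G. rk v = i} = 2"
begin

definition level :: "int \<Rightarrow> 'a set" where
  "level i = {v \<in> verts G. rk v = i}"

text \<open>
  Turning the graph upside down lets every bound near the bottom serve near the top as well.
\<close>

lemma dual: "two_element_levels G (\<lambda>v. n - rk v) n"
proof
  fix x assume "x \<in> verts G"
  then show "neighbours G x = {v \<in> verts G. \<bar>(n - rk v) - (n - rk x)\<bar> = 1}"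
    by (auto simp: neighbours_eq)
next
  fix i assume "0 < i" "i < n"
  moreover have "{v \<in> verts G. n - rk v = i} = {v \<in> verts G. rk v = n - i}"
    by auto
  ultimately show "card {v \<in> verts G. n - rk v = i} = 2"
    using card_middle[of "n - i"] by simp
qed (use rank_bounds card_bottom card_top in \<open>auto simp: eq_commute[of n "rk _"]\<close>)

lemma level_outside: "i < 0 \<or> i > n \<Longrightarrow> level i = {}"
  using rank_bounds by (force simp: level_def)

lemma card_level_le: "card (level i) \<le> 2"
proof -
  consider "i < 0 \<or> i > n" | "i = 0" | "i = n" | "0 < i" "i < n" by linarith
  then show ?thesis
    using card_bottom card_top card_middle[of i]
    by cases (auto simp: level_outside, auto simp: level_def)
qed

lemma finite_level: "finite (level i)"
proof (cases "i < 0 \<or> i > n")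
  case False
  then consider "i = 0" | "i = n" | "0 < i" "i < n" by linarith
  then have "card (level i) \<noteq> 0"
    using card_bottom card_top card_middle[of i] by cases (auto simp: level_def)
  then show ?thesis by (meson card.infinite)
qed (simp add: level_outside)

lemma singleton_level:
  assumes "i = 0 \<or> i = n"
  obtains w where "level i = {w}"
  using assms card_bottom card_top card_1_singletonE unfolding level_def by metis

lemma pair_level:
  assumes "0 < i" "i < n"
  obtains p q where "p \<noteq> q" "level i = {p, q}"
  using card_middle[OF assms] unfolding level_def card_2_iff by blast

lemma twin:
  assumes "x \<in> verts G" "0 < rk x" "rk x < n"
  obtains z where "z \<noteq> x" "level (rk x) = {x, z}"
proof -
  obtain p q where "p \<noteq> q" "level (rk x) = {p, q}"
    using pair_level[OF assms(2,3)] .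
  moreover have "x \<in> level (rk x)" using assms(1) by (simp add: level_def)
  ultimately show thesis using that[of q] that[of p] by auto
qed

lemma vertex_of_rank:
  assumes "0 \<le> i" "i \<le> n"
  obtains x where "x \<in> verts G" "rk x = i"
proof -
  consider "i = 0" | "i = n" | "0 < i" "i < n" using assms by linarith
  then have "card (level i) \<noteq> 0"
    using card_bottom card_top card_middle[of i] by cases (auto simp: level_def)
  then obtain x where "x \<in> level i" by (metis card.empty equals0I)
  then show thesis using that by (auto simp: level_def)
qed

lemma neighbours_levels:
  assumes "x \<in> verts G" "rk x = i"
  shows "neighbours G x = level (i - 1) \<union> level (i + 1)"
proof -
  have "\<bar>j - i\<bar> = 1 \<longleftrightarrow> j = i - 1 \<or> j = i + 1" for j by arith
  then show ?thesis
    unfolding neighbours_eq[OF assms(1)] level_def assms(2) by blast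
qed

lemma level_disjoint: "i \<noteq> j \<Longrightarrow> level i \<inter> level j = {}"
  by (auto simp: level_def)

lemma sum_neighbours:
  assumes "x \<in> verts G" "rk x = i"
  shows "sum F (neighbours G x) = sum F (level (i - 1)) + sum F (level (i + 1))"
  unfolding neighbours_levels[OF assms]
  by (rule sum.union_disjoint[OF finite_level finite_level level_disjoint]) simp

lemma card_neighbours:
  assumes "x \<in> verts G" "rk x = i"
  shows "card (neighbours G x) = card (level (i - 1)) + card (level (i + 1))"
  unfolding neighbours_levels[OF assms]
  by (rule card_Un_disjoint[OF finite_level finite_level level_disjoint]) simp

lemma sum_neighbours_of_level:
  assumes "v \<in> level j"
  shows "sum F (neighbours G v) = sum F (level (j - 1)) + sum F (level (j + 1))"
proof -
  from assms have "v \<in> verts G" "rk v = j" by (simp_all add: level_def)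
  then show ?thesis by (rule sum_neighbours)
qed

text \<open>
  The equation for \<open>D\<close> is a hypothesis on a free variable, not a definition, so that users can name
  the sums over the outer levels and treat them as opaque numbers in the polynomial identities.
\<close>

lemma Gamma2_levels:
  fixes f :: "'a \<Rightarrow> real"
  assumes x: "x \<in> verts G" "rk x = i"
    and D: "\<And>j c. D j c = (\<Sum>u\<in>level j. (f u - f x - 2 * c)\<^sup>2 - c\<^sup>2)"
  defines "g \<equiv> \<lambda>v. f v - f x"
  shows "4 * Gamma2 G f x =
    (\<Sum>v\<in>level (i - 1). D (i - 2) (g v) + D i (g v))
    + (\<Sum>v\<in>level (i + 1). D i (g v) + D (i + 2) (g v))
    - real (card (level (i - 1)) + card (level (i + 1)))
      * ((\<Sum>v\<in>level (i - 1). (g v)\<^sup>2) + (\<Sum>v\<in>level (i + 1). (g v)\<^sup>2))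
    + 2 * ((\<Sum>v\<in>level (i - 1). g v) + (\<Sum>v\<in>level (i + 1). g v))\<^sup>2"
proof -
  have "(\<Sum>u\<in>neighbours G v. (f u - f x - 2 * (f v - f x))\<^sup>2 - (f v - f x)\<^sup>2) =
      D (j - 1) (f v - f x) + D (j + 1) (f v - f x)" if "v \<in> level j" for v j
    unfolding D by (rule sum_neighbours_of_level[OF that])
  from this[of _ "i - 1"] this[of _ "i + 1"] show ?thesis
    unfolding four_Gamma2 sum_neighbours[OF x] card_neighbours[OF x] g_def
    by (simp add: diff_diff_eq add.assoc)
qed

lemma Gamma1_levels:
  assumes x: "x \<in> verts G" "rk x = i"
  shows "4 * Gamma1 G f f x =
    2 * ((\<Sum>v\<in>level (i - 1). (f v - f x)\<^sup>2) + (\<Sum>v\<in>level (i + 1). (f v - f x)\<^sup>2))"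
  unfolding four_Gamma1 sum_neighbours[OF x] ..

section \<open>The local quadratic forms\<close>

text \<open>
  A vertex at distance two is adjacent to both vertices \<open>p\<close>, \<open>q\<close> of the level in between. With
  \<open>P\<close>, \<open>Q\<close> the values there, its two contributions are minimal at the value \<open>P + Q\<close>.
\<close>

lemma outer_square_completion:
  fixes P Q :: real and A :: "'b set" and h :: "'b \<Rightarrow> real"
  shows "(\<Sum>u\<in>A. (h u - 2 * P)\<^sup>2 - P\<^sup>2) + (\<Sum>u\<in>A. (h u - 2 * Q)\<^sup>2 - Q\<^sup>2) =
    2 * (\<Sum>u\<in>A. (h u - P - Q)\<^sup>2) + real (card A) * (2 * (P - Q)\<^sup>2 - P\<^sup>2 - Q\<^sup>2)"
proof -
  have "(\<Sum>u\<in>A. (h u - 2 * P)\<^sup>2 - P\<^sup>2) + (\<Sum>u\<in>A. (h u - 2 * Q)\<^sup>2 - Q\<^sup>2) =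
      (\<Sum>u\<in>A. 2 * (h u - P - Q)\<^sup>2 + (2 * (P - Q)\<^sup>2 - P\<^sup>2 - Q\<^sup>2))"
    unfolding sum.distrib[symmetric]
    by (intro sum.cong refl) (simp add: power2_eq_square algebra_simps)
  then show ?thesis by (simp add: sum.distrib sum_distrib_left)
qed

text \<open>
  In the next three identities the sums over outer levels, and in the last two also the square that
  contains \<open>Z\<close>, vanish for a suitable choice of \<open>f\<close> off the star of \<open>x\<close>. The remaining terms
  are therefore the exact minimum of \<open>\<Gamma>\<^sub>2\<close> for given differences along the edges at \<open>x\<close>.
\<close>

lemma Gamma_bottom:
  fixes f :: "'a \<Rightarrow> real"
  assumes x: "x \<in> verts G" "rk x = 0"
    and above: "level 1 = {p, q}" "p \<noteq> q"
  defines "P \<equiv> f p - f x" and "Q \<equiv> f q - f x"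
    and "\<beta> \<equiv> real (card (level 2))"
  shows "4 * Gamma2 G f x = (5 - \<beta>) * (P\<^sup>2 + Q\<^sup>2) + 2 * (\<beta> - 1) * (P - Q)\<^sup>2
      + 2 * (\<Sum>u\<in>level 2. (f u - f x - P - Q)\<^sup>2)" (is ?Gamma2)
    and "4 * Gamma1 G f f x = 2 * (P\<^sup>2 + Q\<^sup>2)" (is ?Gamma1)
proof -
  have empty: "level (- 1) = {}" "level (- 2) = {}" by (simp_all add: level_outside)
  obtain w where "level 0 = {w}" using singleton_level[of 0] by blast
  moreover have "x \<in> level 0" using x by (simp add: level_def)
  ultimately have same: "level 0 = {x}" by simp
  show ?Gamma1
    using Gamma1_levels[OF x, of f] above(2) by (simp add: above empty P_def Q_def)
  define A where "A j v = (\<Sum>u\<in>level j. (f u - f x - 2 * v)\<^sup>2 - v\<^sup>2)" for j v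
  have A0: "A 0 v = 4 * v\<^sup>2 - v\<^sup>2" for v
    by (simp add: A_def same power_mult_distrib)
  have "A 2 P + A 2 Q = 2 * (\<Sum>u\<in>level 2. (f u - f x - P - Q)\<^sup>2) + \<beta> * (2 * (P - Q)\<^sup>2 - P\<^sup>2 - Q\<^sup>2)"
    unfolding A_def \<beta>_def by (rule outer_square_completion)
  moreover have "4 * Gamma2 G f x =
      4 * P\<^sup>2 - P\<^sup>2 + A 2 P + (4 * Q\<^sup>2 - Q\<^sup>2 + A 2 Q) - 2 * (P\<^sup>2 + Q\<^sup>2) + 2 * (P + Q)\<^sup>2"
    using Gamma2_levels[OF x, of A f, OF A_def] above(2)
    by (simp add: above empty A0 flip: P_def Q_def)
  moreover have "4 * P\<^sup>2 - P\<^sup>2 + (4 * Q\<^sup>2 - Q\<^sup>2) - 2 * (P\<^sup>2 + Q\<^sup>2) + 2 * (P + Q)\<^sup>2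
      + \<beta> * (2 * (P - Q)\<^sup>2 - P\<^sup>2 - Q\<^sup>2) = (5 - \<beta>) * (P\<^sup>2 + Q\<^sup>2) + 2 * (\<beta> - 1) * (P - Q)\<^sup>2"
    by algebra
  ultimately show ?Gamma2 by linarith
qed

text \<open>
  The other atom \<open>z\<close> shares all three neighbours with \<open>x\<close>, so \<open>Z\<close> enters through three squares
  \<open>(Z - 2 R)\<^sup>2\<close>, \<open>(Z - 2 P)\<^sup>2\<close>, \<open>(Z - 2 Q)\<^sup>2\<close>, whose sum is minimal at \<open>Z = 2/3 (R + P + Q)\<close>.
\<close>

lemma Gamma_atom:
  fixes f :: "'a \<Rightarrow> real"
  assumes x: "x \<in> verts G" "rk x = 1"
    and same: "level 1 = {x, z}" "z \<noteq> x"
    and below: "level 0 = {r}"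
    and above: "level 2 = {p, q}" "p \<noteq> q"
  defines "Z \<equiv> f z - f x" and "R \<equiv> f r - f x" and "P \<equiv> f p - f x" and "Q \<equiv> f q - f x"
    and "\<beta> \<equiv> real (card (level 3))"
  shows "4 * Gamma2 G f x = 3 * R\<^sup>2 + (3 - \<beta>) * (P\<^sup>2 + Q\<^sup>2) + 2 * \<beta> * (P - Q)\<^sup>2
      + 2/3 * (R + P + Q)\<^sup>2 + 1/3 * (3 * Z - 2 * (R + P + Q))\<^sup>2
      + 2 * (\<Sum>u\<in>level 3. (f u - f x - P - Q)\<^sup>2)" (is ?Gamma2)
    and "4 * Gamma1 G f f x = 2 * (R\<^sup>2 + P\<^sup>2 + Q\<^sup>2)" (is ?Gamma1)
proof -
  have empty: "level (- 1) = {}" by (simp add: level_outside)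
  show ?Gamma1
    using Gamma1_levels[OF x, of f] above(2) by (simp add: below above R_def P_def Q_def)
  define A where "A j v = (\<Sum>u\<in>level j. (f u - f x - 2 * v)\<^sup>2 - v\<^sup>2)" for j v
  define B where "B v = 4 * v\<^sup>2 - v\<^sup>2 + ((Z - 2 * v)\<^sup>2 - v\<^sup>2)" for v
  have B: "A 1 v = B v" for v
    using same(2)[symmetric] by (simp add: A_def B_def same(1) power_mult_distrib Z_def)
  have A_empty: "A (- 1) v = 0" for v by (simp add: A_def empty)
  have "A 3 P + A 3 Q = 2 * (\<Sum>u\<in>level 3. (f u - f x - P - Q)\<^sup>2) + \<beta> * (2 * (P - Q)\<^sup>2 - P\<^sup>2 - Q\<^sup>2)"
    unfolding A_def \<beta>_def by (rule outer_square_completion)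
  moreover have "4 * Gamma2 G f x = B R + (B P + A 3 P) + (B Q + A 3 Q)
      - 3 * (R\<^sup>2 + P\<^sup>2 + Q\<^sup>2) + 2 * (R + P + Q)\<^sup>2"
    using Gamma2_levels[OF x, of A f, OF A_def] above(2)
    by (simp add: below above A_empty B add.assoc flip: R_def P_def Q_def)
  moreover have "B R + B P + B Q - 3 * (R\<^sup>2 + P\<^sup>2 + Q\<^sup>2) + 2 * (R + P + Q)\<^sup>2
      + \<beta> * (2 * (P - Q)\<^sup>2 - P\<^sup>2 - Q\<^sup>2) =
      3 * R\<^sup>2 + (3 - \<beta>) * (P\<^sup>2 + Q\<^sup>2) + 2 * \<beta> * (P - Q)\<^sup>2
      + 2/3 * (R + P + Q)\<^sup>2 + 1/3 * (3 * Z - 2 * (R + P + Q))\<^sup>2"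
    unfolding B_def by (simp add: power2_eq_square field_simps)
  ultimately show ?Gamma2 by linarith
qed

text \<open>
  The twin \<open>z\<close> now shares four neighbours with \<open>x\<close>, and its optimal value is half their sum. An
  outer level of full size \<open>2\<close> removes the positive term \<open>(2 - \<alpha>) (R\<^sup>2 + S\<^sup>2)\<close> or
  \<open>(2 - \<beta>) (P\<^sup>2 + Q\<^sup>2)\<close>; this is why the curvature drops from \<open>n = 4\<close> to \<open>n = 6\<close>.
\<close>

lemma Gamma_interior:
  fixes f :: "'a \<Rightarrow> real"
  assumes x: "x \<in> verts G" "rk x = i"
    and same: "level i = {x, z}" "z \<noteq> x"
    and below: "level (i - 1) = {r, s}" "r \<noteq> s"
    and above: "level (i + 1) = {p, q}" "p \<noteq> q"
  defines "Z \<equiv> f z - f x" and "R \<equiv> f r - f x" and "S \<equiv> f s - f x"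
    and "P \<equiv> f p - f x" and "Q \<equiv> f q - f x"
    and "\<alpha> \<equiv> real (card (level (i - 2)))" and "\<beta> \<equiv> real (card (level (i + 2)))"
  shows "4 * Gamma2 G f x = (2 - \<alpha>) * (R\<^sup>2 + S\<^sup>2) + (2 - \<beta>) * (P\<^sup>2 + Q\<^sup>2)
      + 2 * \<alpha> * (R - S)\<^sup>2 + 2 * \<beta> * (P - Q)\<^sup>2
      + (R + S + P + Q)\<^sup>2 + (2 * Z - (R + S + P + Q))\<^sup>2
      + 2 * (\<Sum>u\<in>level (i - 2). (f u - f x - R - S)\<^sup>2)
      + 2 * (\<Sum>u\<in>level (i + 2). (f u - f x - P - Q)\<^sup>2)" (is ?Gamma2)
    and "4 * Gamma1 G f f x = 2 * (R\<^sup>2 + S\<^sup>2 + P\<^sup>2 + Q\<^sup>2)" (is ?Gamma1)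
proof -
  show ?Gamma1
    using Gamma1_levels[OF x, of f] below(2) above(2)
    by (simp add: below above R_def S_def P_def Q_def)
  define A where "A j v = (\<Sum>u\<in>level j. (f u - f x - 2 * v)\<^sup>2 - v\<^sup>2)" for j v
  define B where "B v = 4 * v\<^sup>2 - v\<^sup>2 + ((Z - 2 * v)\<^sup>2 - v\<^sup>2)" for v
  have B: "A i v = B v" for v
    using same(2)[symmetric] by (simp add: A_def B_def same(1) power_mult_distrib Z_def)
  have "A (i + 2) P + A (i + 2) Q =
      2 * (\<Sum>u\<in>level (i + 2). (f u - f x - P - Q)\<^sup>2) + \<beta> * (2 * (P - Q)\<^sup>2 - P\<^sup>2 - Q\<^sup>2)"
    unfolding A_def \<beta>_def by (rule outer_square_completion)
  moreover have "A (i - 2) R + A (i - 2) S =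
      2 * (\<Sum>u\<in>level (i - 2). (f u - f x - R - S)\<^sup>2) + \<alpha> * (2 * (R - S)\<^sup>2 - R\<^sup>2 - S\<^sup>2)"
    unfolding A_def \<alpha>_def by (rule outer_square_completion)
  moreover have "4 * Gamma2 G f x =
      (A (i - 2) R + B R) + (A (i - 2) S + B S) + (B P + A (i + 2) P) + (B Q + A (i + 2) Q)
      - 4 * (R\<^sup>2 + S\<^sup>2 + P\<^sup>2 + Q\<^sup>2) + 2 * (R + S + P + Q)\<^sup>2"
    using Gamma2_levels[OF x, of A f, OF A_def] below(2) above(2)
    by (simp add: below above B add.assoc flip: R_def S_def P_def Q_def)
  moreover have "B R + B S + B P + B Q - 4 * (R\<^sup>2 + S\<^sup>2 + P\<^sup>2 + Q\<^sup>2) + 2 * (R + S + P + Q)\<^sup>2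
      + \<alpha> * (2 * (R - S)\<^sup>2 - R\<^sup>2 - S\<^sup>2) + \<beta> * (2 * (P - Q)\<^sup>2 - P\<^sup>2 - Q\<^sup>2) =
      (2 - \<alpha>) * (R\<^sup>2 + S\<^sup>2) + (2 - \<beta>) * (P\<^sup>2 + Q\<^sup>2)
      + 2 * \<alpha> * (R - S)\<^sup>2 + 2 * \<beta> * (P - Q)\<^sup>2
      + (R + S + P + Q)\<^sup>2 + (2 * Z - (R + S + P + Q))\<^sup>2"
    unfolding B_def by algebra
  ultimately show ?Gamma2 by linarith
qed

section \<open>Lower curvature bounds vertex by vertex\<close>

lemma card_pair_level: "0 < i \<Longrightarrow> i < n \<Longrightarrow> card (level i) = 2"
  using card_middle by (simp add: level_def)

lemma card_end_level: "i = 0 \<or> i = n \<Longrightarrow> card (level i) = 1"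
  using card_bottom card_top by (auto simp: level_def)

lemma bottom_bound:
  assumes "x \<in> verts G" "rk x = 0" "n \<ge> 3"
  shows "Gamma2 G f x \<ge> 3/2 * Gamma1 G f f x"
proof -
  obtain p q where pq: "p \<noteq> q" "level 1 = {p, q}" using pair_level[of 1] assms(3) by auto
  have c2: "card (level 2) = 2" using assms(3) by (intro card_pair_level) auto
  note forms = Gamma_bottom[OF assms(1,2) pq(2,1), of f, unfolded c2]
  have "(5 - real 2) * ((f p - f x)\<^sup>2 + (f q - f x)\<^sup>2) \<le> 4 * Gamma2 G f x"
    by (rule le_of_eq_add_nonneg[OF forms(1)]) (simp_all add: sum_nonneg)
  with forms(2) show ?thesis by simp
qed

text \<open>
  For lower bounds the completed squares can be dropped, and with them all values of \<open>f\<close> off the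
  star of \<open>x\<close>.
\<close>

lemma atom_forms:
  fixes f :: "'a \<Rightarrow> real"
  assumes x: "x \<in> verts G" "rk x = 1" and n: "n \<ge> 3"
  defines "\<beta> \<equiv> real (card (level 3))"
  obtains R P Q where
    "4 * Gamma2 G f x \<ge> 3 * R\<^sup>2 + (3 - \<beta>) * (P\<^sup>2 + Q\<^sup>2) + 2 * \<beta> * (P - Q)\<^sup>2
      + 2/3 * (R + P + Q)\<^sup>2"
    and "4 * Gamma1 G f f x = 2 * (R\<^sup>2 + P\<^sup>2 + Q\<^sup>2)"
proof -
  obtain z where z: "z \<noteq> x" "level 1 = {x, z}" using twin[of x] x n by auto
  obtain r where r: "level 0 = {r}" using singleton_level[of 0] by auto
  obtain p q where pq: "p \<noteq> q" "level 2 = {p, q}" using pair_level[of 2] n by auto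
  note forms = Gamma_atom[OF x z(2,1) r pq(2,1), of f, folded \<beta>_def]
  show thesis
    by (rule that[OF le_of_eq_add_nonneg[OF forms(1)] forms(2)]) (simp_all add: sum_nonneg)
qed

lemma atom_bound:
  assumes x: "x \<in> verts G" "rk x = 1" and n: "n \<ge> 4"
  shows "Gamma2 G f x \<ge> 1/2 * Gamma1 G f f x"
proof -
  have c3: "card (level 3) = 2" using n by (intro card_pair_level) auto
  obtain R P Q where
    "4 * Gamma2 G f x \<ge> 3 * R\<^sup>2 + (P\<^sup>2 + Q\<^sup>2) + 4 * (P - Q)\<^sup>2 + 2/3 * (R + P + Q)\<^sup>2"
    and "4 * Gamma1 G f f x = 2 * (R\<^sup>2 + P\<^sup>2 + Q\<^sup>2)"
    using atom_forms[OF x, of f] n unfolding c3 by auto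
  moreover have "(P - Q)\<^sup>2 \<ge> 0" "(R + P + Q)\<^sup>2 \<ge> 0" "R\<^sup>2 \<ge> 0" by simp_all
  ultimately show ?thesis by argo
qed

text \<open>
  The condition on \<open>K\<close> says that the binary form in \<open>R\<close> and \<open>P + Q\<close> is degenerate; the difference
  \<open>P - Q\<close> splits off with the positive coefficient \<open>3 - K\<close>.
\<close>

lemma atom_bound_of_three_levels:
  assumes x: "x \<in> verts G" "rk x = 1" and n: "n = 3"
    and K: "K < 11/6" "(11/3 - 2 * K) * (5/3 - K) = (2/3)\<^sup>2"
  shows "Gamma2 G f x \<ge> K * Gamma1 G f f x"
proof -
  have c3: "card (level 3) = 1" using n by (intro card_end_level) auto
  obtain R P Q where
    "4 * Gamma2 G f x \<ge> 3 * R\<^sup>2 + 2 * (P\<^sup>2 + Q\<^sup>2) + 2 * (P - Q)\<^sup>2 + 2/3 * (R + P + Q)\<^sup>2"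
    and G1: "4 * Gamma1 G f f x = 2 * (R\<^sup>2 + P\<^sup>2 + Q\<^sup>2)"
    using atom_forms[OF x, of f] n unfolding c3 by auto
  moreover have "4 * (K * Gamma1 G f f x) = 2 * K * (R\<^sup>2 + P\<^sup>2 + Q\<^sup>2)"
    using G1 by algebra
  moreover have "3 * R\<^sup>2 + 2 * (P\<^sup>2 + Q\<^sup>2) + 2 * (P - Q)\<^sup>2 + 2/3 * (R + P + Q)\<^sup>2
      - 2 * K * (R\<^sup>2 + P\<^sup>2 + Q\<^sup>2) =
      ((11/3 - 2 * K) * R\<^sup>2 + 2 * (2/3) * R * (P + Q) + (5/3 - K) * (P + Q)\<^sup>2)
      + (3 - K) * (P - Q)\<^sup>2"
    by (simp add: power2_eq_square field_simps)
  moreover have "(11/3 - 2 * K) * R\<^sup>2 + 2 * (2/3) * R * (P + Q) + (5/3 - K) * (P + Q)\<^sup>2 \<ge> 0"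
    using K by (intro binary_form_nonneg) auto
  moreover have "(3 - K) * (P - Q)\<^sup>2 \<ge> 0" using K(1) by simp
  ultimately show ?thesis by linarith
qed

lemma interior_forms:
  fixes f :: "'a \<Rightarrow> real"
  assumes x: "x \<in> verts G" "rk x = i" and i: "2 \<le> i" "i \<le> n - 2"
  defines "\<alpha> \<equiv> real (card (level (i - 2)))" and "\<beta> \<equiv> real (card (level (i + 2)))"
  obtains R S P Q where
    "4 * Gamma2 G f x \<ge> (2 - \<alpha>) * (R\<^sup>2 + S\<^sup>2) + (2 - \<beta>) * (P\<^sup>2 + Q\<^sup>2)
      + 2 * \<alpha> * (R - S)\<^sup>2 + 2 * \<beta> * (P - Q)\<^sup>2 + (R + S + P + Q)\<^sup>2"
    and "4 * Gamma1 G f f x = 2 * (R\<^sup>2 + S\<^sup>2 + P\<^sup>2 + Q\<^sup>2)"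
proof -
  obtain z where z: "z \<noteq> x" "level i = {x, z}" using twin[of x] x i by auto
  obtain r s where rs: "r \<noteq> s" "level (i - 1) = {r, s}" using pair_level[of "i - 1"] i by auto
  obtain p q where pq: "p \<noteq> q" "level (i + 1) = {p, q}" using pair_level[of "i + 1"] i by auto
  note forms = Gamma_interior[OF x z(2,1) rs(2,1) pq(2,1), of f, folded \<alpha>_def \<beta>_def]
  show thesis
    by (rule that[OF le_of_eq_add_nonneg[OF forms(1)[unfolded add.assoc[of _ "2 * sum _ _"]]] forms(2)])
      (simp_all add: sum_nonneg)
qed

lemma interior_nonneg:
  assumes "x \<in> verts G" "2 \<le> rk x" "rk x \<le> n - 2"
  shows "Gamma2 G f x \<ge> 0"
proof -
  define a b where "a = real (card (level (rk x - 2)))" and "b = real (card (level (rk x + 2)))"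
  have ab: "0 \<le> a" "a \<le> 2" "0 \<le> b" "b \<le> 2"
    using card_level_le[of "rk x - 2"] card_level_le[of "rk x + 2"] by (auto simp: a_def b_def)
  obtain R S P Q where
    "4 * Gamma2 G f x \<ge> (2 - a) * (R\<^sup>2 + S\<^sup>2) + (2 - b) * (P\<^sup>2 + Q\<^sup>2)
      + 2 * a * (R - S)\<^sup>2 + 2 * b * (P - Q)\<^sup>2 + (R + S + P + Q)\<^sup>2"
    using interior_forms[OF assms(1) refl assms(2,3), of f] unfolding a_def b_def .
  moreover have "(2 - a) * (R\<^sup>2 + S\<^sup>2) + (2 - b) * (P\<^sup>2 + Q\<^sup>2)
      + 2 * a * (R - S)\<^sup>2 + 2 * b * (P - Q)\<^sup>2 + (R + S + P + Q)\<^sup>2 \<ge> 0"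
    using ab by (intro add_nonneg_nonneg mult_nonneg_nonneg) auto
  ultimately show ?thesis by linarith
qed

lemma centre_bound_of_four_levels:
  assumes x: "x \<in> verts G" "rk x = 2" and n: "n = 4"
  shows "Gamma2 G f x \<ge> 1/2 * Gamma1 G f f x"
proof -
  have c: "card (level (2 - 2)) = 1" "card (level (2 + 2)) = 1"
    using n by (intro card_end_level, simp)+
  have "(2 :: int) \<le> 2" "2 \<le> n - 2" using n by simp_all
  then obtain R S P Q where
    "4 * Gamma2 G f x \<ge> (2 - real 1) * (R\<^sup>2 + S\<^sup>2) + (2 - real 1) * (P\<^sup>2 + Q\<^sup>2)
      + 2 * real 1 * (R - S)\<^sup>2 + 2 * real 1 * (P - Q)\<^sup>2 + (R + S + P + Q)\<^sup>2"
    and G1: "4 * Gamma1 G f f x = 2 * (R\<^sup>2 + S\<^sup>2 + P\<^sup>2 + Q\<^sup>2)"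
    using interior_forms[OF x, of f] unfolding c by metis
  then have "4 * Gamma2 G f x \<ge> (R\<^sup>2 + S\<^sup>2) + (P\<^sup>2 + Q\<^sup>2)
      + 2 * (R - S)\<^sup>2 + 2 * (P - Q)\<^sup>2 + (R + S + P + Q)\<^sup>2" by simp
  moreover note G1
  moreover have "(R - S)\<^sup>2 \<ge> 0" "(P - Q)\<^sup>2 \<ge> 0" "(R + S + P + Q)\<^sup>2 \<ge> 0" by simp_all
  ultimately show ?thesis by argo
qed

text \<open>
  Here the degenerate binary form is in \<open>R + S\<close> and \<open>P + Q\<close>. The symmetry between up and down is
  broken, because the level two steps below \<open>x\<close> has one vertex and the level two steps above has two.
\<close>

lemma second_level_bound_of_five_levels:
  assumes x: "x \<in> verts G" "rk x = 2" and n: "n = 5"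
    and K: "K < 3/2" "(3/2 - K) * (1 - K) = 1\<^sup>2"
  shows "Gamma2 G f x \<ge> K * Gamma1 G f f x"
proof -
  have c: "card (level (2 - 2)) = 1" "card (level (2 + 2)) = 2"
    using card_end_level[of 0] card_pair_level[of 4] n by simp_all
  have "(2 :: int) \<le> 2" "2 \<le> n - 2" using n by simp_all
  then obtain R S P Q where
    "4 * Gamma2 G f x \<ge> (2 - real 1) * (R\<^sup>2 + S\<^sup>2) + (2 - real 2) * (P\<^sup>2 + Q\<^sup>2)
      + 2 * real 1 * (R - S)\<^sup>2 + 2 * real 2 * (P - Q)\<^sup>2 + (R + S + P + Q)\<^sup>2"
    and G1: "4 * Gamma1 G f f x = 2 * (R\<^sup>2 + S\<^sup>2 + P\<^sup>2 + Q\<^sup>2)"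
    using interior_forms[OF x, of f] unfolding c by metis
  then have
    "4 * Gamma2 G f x \<ge> (R\<^sup>2 + S\<^sup>2) + 2 * (R - S)\<^sup>2 + 4 * (P - Q)\<^sup>2 + (R + S + P + Q)\<^sup>2"
    by simp
  moreover have "4 * (K * Gamma1 G f f x) = 2 * K * (R\<^sup>2 + S\<^sup>2 + P\<^sup>2 + Q\<^sup>2)"
    using G1 by algebra
  moreover have "(R\<^sup>2 + S\<^sup>2) + 2 * (R - S)\<^sup>2 + 4 * (P - Q)\<^sup>2 + (R + S + P + Q)\<^sup>2
      - 2 * K * (R\<^sup>2 + S\<^sup>2 + P\<^sup>2 + Q\<^sup>2) =
      ((3/2 - K) * (R + S)\<^sup>2 + 2 * 1 * (R + S) * (P + Q) + (1 - K) * (P + Q)\<^sup>2)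
      + (5/2 - K) * (R - S)\<^sup>2 + (4 - K) * (P - Q)\<^sup>2"
    by (simp add: power2_eq_square field_simps)
  moreover have "(3/2 - K) * (R + S)\<^sup>2 + 2 * 1 * (R + S) * (P + Q) + (1 - K) * (P + Q)\<^sup>2 \<ge> 0"
    using K by (intro binary_form_nonneg) auto
  moreover have "(5/2 - K) * (R - S)\<^sup>2 \<ge> 0" "(4 - K) * (P - Q)\<^sup>2 \<ge> 0" using K(1) by simp_all
  ultimately show ?thesis by linarith
qed

section \<open>The curvature in each case\<close>

lemma curvature_boundI:
  assumes "K \<le> 3/2" "n \<ge> 3"
    and atoms: "\<And>x f. x \<in> verts G \<Longrightarrow> rk x = 1 \<or> rk x = n - 1 \<Longrightarrow> Gamma2 G f x \<ge> K * Gamma1 G f f x"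
    and interior: "\<And>x f. x \<in> verts G \<Longrightarrow> 2 \<le> rk x \<Longrightarrow> rk x \<le> n - 2 \<Longrightarrow>
      Gamma2 G f x \<ge> K * Gamma1 G f f x"
  shows "curvature_bound G K"
  unfolding curvature_bound_def
proof (intro allI ballI)
  fix f x assume x: "x \<in> verts G"
  interpret dual: two_element_levels G "\<lambda>v. n - rk v" n by (rule dual)
  consider "rk x = 0" | "n - rk x = 0" | "rk x = 1 \<or> rk x = n - 1" | "2 \<le> rk x" "rk x \<le> n - 2"
    using rank_bounds[OF x] by linarith
  then show "K * Gamma1 G f f x \<le> Gamma2 G f x"
  proof cases
    case 1
    then show ?thesis
      using bottom_bound[OF x 1 assms(2), of f] mult_right_mono[OF assms(1) Gamma1_nonneg[of G f x]]
      by linarith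
  next
    case 2
    then show ?thesis
      using dual.bottom_bound[OF x 2 assms(2), of f]
        mult_right_mono[OF assms(1) Gamma1_nonneg[of G f x]]
      by linarith
  qed (use x atoms interior in auto)
qed

lemma Ric_three:
  assumes n: "n = 3"
  shows "Ric G = ereal ((21 - sqrt 33) / 12)"
proof -
  interpret dual: two_element_levels G "\<lambda>v. n - rk v" n by (rule dual)
  define w K where "w = sqrt 33" and "K = (21 - w) / 12"
  have w: "w\<^sup>2 = 33" by (simp add: w_def)
  have K: "(11/3 - 2 * K) * (5/3 - K) = (2/3)\<^sup>2" "K < 11/6" "K \<le> 3/2"
  proof -
    show "(11/3 - 2 * K) * (5/3 - K) = (2/3)\<^sup>2"
      using w unfolding K_def by (simp add: power2_eq_square field_simps)
    have "w \<ge> 5" unfolding w_def by (rule real_le_rsqrt) simp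
    then show "K < 11/6" "K \<le> 3/2" by (auto simp: K_def)
  qed
  have bound: "curvature_bound G K"
  proof (rule curvature_boundI)
    fix x f assume x: "x \<in> verts G" and "rk x = 1 \<or> rk x = n - 1"
    then consider "rk x = 1" | "n - rk x = 1" by linarith
    then show "K * Gamma1 G f f x \<le> Gamma2 G f x"
      using atom_bound_of_three_levels[OF x _ n K(2,1)]
        dual.atom_bound_of_three_levels[OF x _ n K(2,1)] by cases auto
  qed (use n K in auto)
  obtain x where x: "x \<in> verts G" "rk x = 1" using vertex_of_rank[of 1] n by auto
  obtain z where z: "z \<noteq> x" "level 1 = {x, z}" using twin[of x] x n by auto
  obtain r where r: "level 0 = {r}" using singleton_level[of 0] by auto
  obtain p q where pq: "p \<noteq> q" "level 2 = {p, q}" using pair_level[of 2] n by auto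
  obtain t where t: "level 3 = {t}" using singleton_level[of 3] n by auto
  have ranks: "rk r = 0" "rk z = 1" "rk p = 2" "rk q = 2" "rk t = 3"
    using z(2) r pq(2) t unfolding level_def by blast+
  (* (R, 2) spans the kernel of the binary form; the values at z and t minimise Gamma2. *)
  define R where "R = (1 - w) / 4"
  define f where "f v = (if v = x then 0 else if rk v = 0 then R else if rk v = 1 then 2/3 * (R + 2)
      else if rk v = 2 then 1 else 2)" for v
  have f: "f x = 0" "f r = R" "f z = 2/3 * (R + 2)" "f p = 1" "f q = 1" "f t = 2"
    using ranks x(2) z(1) by (auto simp: f_def)
  have forms: "4 * Gamma2 G f x = 3 * R\<^sup>2 + 4 + 2/3 * (R + 2)\<^sup>2" "4 * Gamma1 G f f x = 2 * (R\<^sup>2 + 2)"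
    using Gamma_atom[OF x z(2,1) r pq(2,1), of f] by (simp_all add: f t add.commute)
  have "2 * R\<^sup>2 = R + 4" "3 * K = 5 + R"
    using w by (simp_all add: R_def K_def power2_eq_square field_simps)
  then have "3 * (3 * R\<^sup>2 + 4 + 2/3 * (R + 2)\<^sup>2) = 3 * (K * (2 * (R\<^sup>2 + 2)))"
    by (simp add: right_diff_distrib distrib_left) algebra
  then have "4 * Gamma2 G f x = K * (4 * Gamma1 G f f x)" unfolding forms by simp
  then have "Gamma2 G f x = K * Gamma1 G f f x" by simp
  moreover have "Gamma1 G f f x > 0" using forms(2) zero_le_power2[of R] by argo
  ultimately show ?thesis
    using Ric_eqI[OF bound x(1)] by (simp add: K_def w_def)
qed

text \<open>
  With both outer levels reduced to one vertex the form at the centre is \<open>R\<^sup>2 + S\<^sup>2 + P\<^sup>2 + Q\<^sup>2\<close>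
  plus squares; the rank function kills these squares.
\<close>

lemma Ric_four:
  assumes n: "n = 4"
  shows "Ric G = ereal (1 / 2)"
proof -
  interpret dual: two_element_levels G "\<lambda>v. n - rk v" n by (rule dual)
  have bound: "curvature_bound G (1 / 2)"
  proof (rule curvature_boundI)
    fix x f assume x: "x \<in> verts G" and "rk x = 1 \<or> rk x = n - 1"
    then consider "rk x = 1" | "n - rk x = 1" by linarith
    then show "1 / 2 * Gamma1 G f f x \<le> Gamma2 G f x"
      using atom_bound[OF x] dual.atom_bound[OF x] n by cases auto
  qed (use n centre_bound_of_four_levels in auto)
  obtain x where x: "x \<in> verts G" "rk x = 2" using vertex_of_rank[of 2] n by auto
  obtain z where z: "z \<noteq> x" "level 2 = {x, z}" using twin[of x] x n by auto
  obtain r s where rs: "r \<noteq> s" "level 1 = {r, s}" using pair_level[of 1] n by auto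
  obtain p q where pq: "p \<noteq> q" "level 3 = {p, q}" using pair_level[of 3] n by auto
  obtain b where b: "level 0 = {b}" using singleton_level[of 0] by auto
  obtain t where t: "level 4 = {t}" using singleton_level[of 4] n by auto
  have ranks: "rk b = 0" "rk r = 1" "rk s = 1" "rk z = 2" "rk p = 3" "rk q = 3" "rk t = 4"
    using z(2) rs(2) pq(2) b t unfolding level_def by blast+
  have "4 * Gamma2 G (\<lambda>v. of_int (rk v)) x = 4"
    "4 * Gamma1 G (\<lambda>v. of_int (rk v)) (\<lambda>v. of_int (rk v)) x = 8"
    using Gamma_interior[OF x z(2,1), of r s p q "\<lambda>v. of_int (rk v)"] rs pq
    by (simp_all add: ranks x b t)
  then show ?thesis by (intro Ric_eqI[OF bound x(1), of "\<lambda>v. of_int (rk v)"]) auto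
qed

lemma Ric_five:
  assumes n: "n = 5"
  shows "Ric G = ereal ((5 - sqrt 17) / 4)"
proof -
  interpret dual: two_element_levels G "\<lambda>v. n - rk v" n by (rule dual)
  define w K where "w = sqrt 17" and "K = (5 - w) / 4"
  have w: "w\<^sup>2 = 17" by (simp add: w_def)
  have K: "(3/2 - K) * (1 - K) = 1\<^sup>2" "K < 3/2" "K \<le> 1/2"
  proof -
    show "(3/2 - K) * (1 - K) = 1\<^sup>2"
      using w unfolding K_def by (simp add: power2_eq_square field_simps)
    have "w \<ge> 4" unfolding w_def by (rule real_le_rsqrt) simp
    then show "K < 3/2" "K \<le> 1/2" by (auto simp: K_def)
  qed
  have bound: "curvature_bound G K"
  proof (rule curvature_boundI)
    fix x f assume x: "x \<in> verts G" and "rk x = 1 \<or> rk x = n - 1"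
    then consider "rk x = 1" | "n - rk x = 1" by linarith
    then have "1 / 2 * Gamma1 G f f x \<le> Gamma2 G f x"
      using atom_bound[OF x] dual.atom_bound[OF x] n by cases auto
    then show "K * Gamma1 G f f x \<le> Gamma2 G f x"
      using mult_right_mono[OF K(3) Gamma1_nonneg[of G f x]] by linarith
  next
    fix x f assume x: "x \<in> verts G" and "2 \<le> rk x" "rk x \<le> n - 2"
    then consider "rk x = 2" | "n - rk x = 2" using n by linarith
    then show "K * Gamma1 G f f x \<le> Gamma2 G f x"
      using second_level_bound_of_five_levels[OF x _ n K(2,1)]
        dual.second_level_bound_of_five_levels[OF x _ n K(2,1)] by cases auto
  qed (use n K in auto)
  obtain x where x: "x \<in> verts G" "rk x = 2" using vertex_of_rank[of 2] n by auto
  obtain z where z: "z \<noteq> x" "level 2 = {x, z}" using twin[of x] x n by auto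
  obtain r s where rs: "r \<noteq> s" "level 1 = {r, s}" using pair_level[of 1] n by auto
  obtain p q where pq: "p \<noteq> q" "level 3 = {p, q}" using pair_level[of 3] n by auto
  obtain b where b: "level 0 = {b}" using singleton_level[of 0] by auto
  obtain t u where t: "t \<noteq> u" "level 4 = {t, u}" using pair_level[of 4] n by auto
  have ranks: "rk b = 0" "rk r = 1" "rk s = 1" "rk z = 2" "rk p = 3" "rk q = 3" "rk t = 4" "rk u = 4"
    using z(2) rs(2) pq(2) b t(2) unfolding level_def by blast+
  (* (2 R, 2) spans the kernel of the binary form; the values at z, b, t and u minimise Gamma2. *)
  define R where "R = (1 - w) / 4"
  define f where "f v = (if v = x then 0 else if rk v = 0 then 2 * R else if rk v = 1 then R
      else if rk v = 2 then R + 1 else if rk v = 3 then 1 else 2)" for v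
  have f: "f x = 0" "f b = 2 * R" "f r = R" "f s = R" "f z = R + 1"
    "f p = 1" "f q = 1" "f t = 2" "f u = 2"
    using ranks x(2) z(1) by (auto simp: f_def)
  have forms: "4 * Gamma2 G f x = 2 * R\<^sup>2 + (2 * R + 2)\<^sup>2"
    "4 * Gamma1 G f f x = 4 * (R\<^sup>2 + 1)"
    using Gamma_interior[OF x z(2,1), of r s p q f] rs pq t(1)
    by (simp_all add: f b t(2) add.commute)
  have "2 * R\<^sup>2 = R + 2" "K = 1 + R"
    using w by (simp_all add: R_def K_def power2_eq_square field_simps)
  then have "2 * R\<^sup>2 + (2 * R + 2)\<^sup>2 = K * (4 * (R\<^sup>2 + 1))"
    by algebra
  then have "4 * Gamma2 G f x = K * (4 * Gamma1 G f f x)" unfolding forms by simp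
  then have "Gamma2 G f x = K * Gamma1 G f f x" by simp
  moreover have "Gamma1 G f f x > 0" using forms(2) zero_le_power2[of R] by argo
  ultimately show ?thesis
    using Ric_eqI[OF bound x(1)] by (simp add: K_def w_def)
qed

text \<open>
  Six levels above the bottom are just enough for a vertex of rank \<open>3\<close> whose second neighbours
  avoid both ends. Around it the rank function has vanishing Laplacian and constant \<open>\<Gamma>\<close>.
\<close>

lemma Ric_large:
  assumes n: "n > 5"
  shows "Ric G = 0"
proof -
  interpret dual: two_element_levels G "\<lambda>v. n - rk v" n by (rule dual)
  have bound: "curvature_bound G 0"
  proof (rule curvature_boundI)
    fix x f assume x: "x \<in> verts G" and "rk x = 1 \<or> rk x = n - 1"
    then consider "rk x = 1" | "n - rk x = 1" by linarith
    then have "1 / 2 * Gamma1 G f f x \<le> Gamma2 G f x"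
      using atom_bound[OF x] dual.atom_bound[OF x] n by cases auto
    then show "0 * Gamma1 G f f x \<le> Gamma2 G f x"
      using Gamma1_nonneg[of G f x] by linarith
  qed (use n interior_nonneg in auto)
  obtain x where x: "x \<in> verts G" "rk x = 3" using vertex_of_rank[of 3] n by auto
  obtain z where z: "z \<noteq> x" "level 3 = {x, z}" using twin[of x] x n by auto
  obtain r s where rs: "r \<noteq> s" "level 2 = {r, s}" using pair_level[of 2] n by auto
  obtain p q where pq: "p \<noteq> q" "level 4 = {p, q}" using pair_level[of 4] n by auto
  obtain b c where b: "b \<noteq> c" "level 1 = {b, c}" using pair_level[of 1] n by auto
  obtain t u where t: "t \<noteq> u" "level 5 = {t, u}" using pair_level[of 5] n by auto
  have ranks: "rk b = 1" "rk c = 1" "rk r = 2" "rk s = 2" "rk z = 3" "rk p = 4" "rk q = 4"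
    "rk t = 5" "rk u = 5"
    using z(2) rs(2) pq(2) b(2) t(2) unfolding level_def by blast+
  have "4 * Gamma2 G (\<lambda>v. of_int (rk v)) x = 0"
    "4 * Gamma1 G (\<lambda>v. of_int (rk v)) (\<lambda>v. of_int (rk v)) x = 8"
    using Gamma_interior[OF x z(2,1), of r s p q "\<lambda>v. of_int (rk v)"] rs pq b(1) t(1)
    by (simp_all add: ranks x b(2) t(2))
  then show ?thesis unfolding zero_ereal_def by (intro Ric_eqI[OF bound x(1), of "\<lambda>v. of_int (rk v)"]) auto
qed

end

section \<open>Alternating words in a dihedral group\<close>

text \<open>
  For \<open>m = 0\<close> the order axiom describes the infinite dihedral group, which has no longest element.
\<close>

locale finite_dihedral_system = dihedral_system +
  assumes m_pos: "m > 0"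
begin

primrec alternating :: "'a \<Rightarrow> 'a \<Rightarrow> nat \<Rightarrow> 'a" where
  "alternating a b 0 = \<one>"
| "alternating a b (Suc k) = a \<otimes> alternating b a k"

lemma generator_closed: "a \<in> {s, t} \<Longrightarrow> a \<in> carrier W"
  using s_closed t_closed by auto

lemma generator_square: "a \<in> {s, t} \<Longrightarrow> a \<otimes> a = \<one>"
  using s_square t_square by auto

lemma generator_cancel: "a \<in> {s, t} \<Longrightarrow> y \<in> carrier W \<Longrightarrow> a \<otimes> (a \<otimes> y) = y"
  using generator_closed generator_square by (metis m_assoc l_one)

lemma alternating_closed:
  "a \<in> {s, t} \<Longrightarrow> b \<in> {s, t} \<Longrightarrow> alternating a b k \<in> carrier W"
  by (induction k arbitrary: a b) (auto intro: generator_closed)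

lemma alternating_even:
  assumes "a \<in> {s, t}" "b \<in> {s, t}"
  shows "alternating a b (2 * k) = (a \<otimes> b) [^] k"
proof (induction k)
  case (Suc k)
  have "alternating a b (2 * Suc k) = a \<otimes> (b \<otimes> (a \<otimes> b) [^] k)" by (simp add: Suc)
  also have "\<dots> = (a \<otimes> b) [^] Suc k"
    using assms by (subst nat_pow_Suc2) (auto simp: m_assoc generator_closed)
  finally show ?case .
qed simp

text \<open>
  Cancelling the first \<open>j\<close> letters of the word on the left one by one lets the word on the right grow
  by the same letters; the parity of \<open>j\<close> decides which letters then come first. Applied to the
  relator of length \<open>2 m\<close> this gives the braid relation.
\<close>

lemma alternating_shift:
  assumes "a \<in> {s, t}" "b \<in> {s, t}" "alternating a b (j + k) = alternating b a l"
  shows "if even j then alternating a b k = alternating b a (l + j)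
    else alternating b a k = alternating a b (l + j)"
  using assms
proof (induction j arbitrary: a b l)
  case (Suc j)
  have "alternating b a (j + k) = a \<otimes> alternating b a l"
    using Suc.prems generator_cancel[of a "alternating b a (j + k)"]
    by (simp add: alternating_closed)
  then have "alternating b a (j + k) = alternating a b (Suc l)" by simp
  from Suc.IH[OF Suc.prems(2,1) this] show ?case by (simp split: if_splits)
qed simp

lemma alternating_top: "alternating s t m = alternating t s m"
proof -
  have "alternating s t (m + m) = alternating t s 0"
    using alternating_even[of s t m] st_pow by (simp add: mult_2)
  from alternating_shift[OF _ _ this] show ?thesis by (simp split: if_splits)
qed

definition short_elements :: "nat \<Rightarrow> 'a set" where
  "short_elements k = (\<Union>i\<le>k. {alternating s t i, alternating t s i})"

text \<open>
  Multiplying by a generator either extends the alternating word or deletes its first letter. At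
  length \<open>m\<close> the braid relation turns the extension into a deletion, which is why the bound never
  exceeds \<open>m\<close>.
\<close>

lemma generator_mult_short:
  assumes "a \<in> {s, t}" "y \<in> short_elements k" "k \<le> m"
  shows "a \<otimes> y \<in> short_elements (min (Suc k) m)"
proof -
  obtain b where ab: "{a, b} = {s, t}" using assms(1) by auto
  have mem: "alternating a b i \<in> short_elements j" "alternating b a i \<in> short_elements j"
    if "i \<le> j" for i j
    using ab that unfolding short_elements_def by (auto simp: doubleton_eq_iff)
  have shrink: "a \<otimes> alternating a b i \<in> short_elements (min (Suc k) m)" if "i \<le> k" for i
  proof (cases i)
    case 0
    then show ?thesis using mem(1)[of 1 "min (Suc k) m"] m_pos by simp
  next
    case (Suc j)
    then have "a \<otimes> alternating a b i = alternating b a j"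
      using ab generator_cancel[of a "alternating b a j"] alternating_closed[of b a j] by auto
    then show ?thesis using mem(2)[of j "min (Suc k) m"] Suc that assms(3) by simp
  qed
  obtain i where i: "i \<le> k" "y = alternating a b i \<or> y = alternating b a i"
    using assms(2) ab unfolding short_elements_def by (auto simp: doubleton_eq_iff)
  consider "y = alternating a b i" | "y = alternating b a i" "i < m" | "y = alternating b a i" "i = m"
    using i assms(3) by linarith
  then show ?thesis
  proof cases
    case 1
    then show ?thesis using shrink i(1) by simp
  next
    case 2
    then have "a \<otimes> y = alternating a b (Suc i)" by simp
    then show ?thesis using mem(1)[of "Suc i" "min (Suc k) m"] 2 i(1) by simp
  next
    case 3
    then have "y = alternating a b i"
      using alternating_top ab by (auto simp: doubleton_eq_iff)
    then show ?thesis using shrink i(1) by simp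
  qed
qed

lemma one_short: "\<one> \<in> short_elements k"
  unfolding short_elements_def by (auto intro!: bexI[of _ 0])

lemma short_closed: "short_elements k \<subseteq> carrier W"
  unfolding short_elements_def by (auto simp: alternating_closed)

lemma carrier_short: "carrier W = short_elements m"
proof
  have "\<forall>y\<in>short_elements m. h \<otimes> y \<in> short_elements m" if "h \<in> generate W {s, t}" for h
    using that
  proof (induction rule: generate.induct)
    case one
    then show ?case using subsetD[OF short_closed] by simp
  next
    case (incl h)
    then show ?case using generator_mult_short[of h _ m] by auto
  next
    case (inv h)
    then have "inv h = h"
      using generator_closed generator_square by (intro inv_equality) auto
    then show ?case using generator_mult_short[of h _ m] inv by auto
  next
    case (eng h1 h2)
    moreover have "h1 \<in> carrier W" "h2 \<in> carrier W" using eng generated by auto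
    ultimately show ?case using subsetD[OF short_closed] by (simp add: m_assoc)
  qed
  then show "carrier W \<subseteq> short_elements m"
    using one_short generated by (metis r_one subsetI)
qed (rule short_closed)

text \<open>
  Up to length \<open>m\<close> there are \<open>2 m\<close> alternating words once the two empty words and, by the braid
  relation, the two words of length \<open>m\<close> are identified. They exhaust a group of order \<open>2 m\<close>, so
  counting shows that they are distinct.
\<close>

lemma alternating_index_inj:
  shows "inj_on (\<lambda>(c, i). if c then alternating s t i else alternating t s i)
    ({True} \<times> {..m} \<union> {False} \<times> {0<..<m})"
proof -
  let ?I = "{True} \<times> {..m} \<union> {False} \<times> {0<..<m}"
  let ?f = "\<lambda>(c, i). if c then alternating s t i else alternating t s i"
  have card_I: "card ?I = 2 * m"
    using m_pos by (subst card_Un_disjoint) (auto simp: card_cartesian_product)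
  have "alternating t s i \<in> ?f ` ?I" if "i \<le> m" for i
  proof (cases "0 < i \<and> i < m")
    case True
    then show ?thesis by (intro image_eqI[of _ _ "(False, i)"]) auto
  next
    case False
    then have "i = 0 \<or> i = m" using that by auto
    then have "alternating t s i = alternating s t i" using alternating_top by auto
    then show ?thesis using that by (intro image_eqI[of _ _ "(True, i)"]) auto
  qed
  moreover have "alternating s t i \<in> ?f ` ?I" if "i \<le> m" for i
    using that by (intro image_eqI[of _ _ "(True, i)"]) auto
  ultimately have "carrier W \<subseteq> ?f ` ?I"
    unfolding carrier_short short_elements_def by auto
  then have "order W \<le> card (?f ` ?I)"
    unfolding order_def by (intro card_mono) auto
  then have "card (?f ` ?I) = card ?I"
    using card_image_le[of ?I ?f] card_I order_W by simp
  then show ?thesis by (intro eq_card_imp_inj_on) auto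
qed

lemma alternating_distinct:
  assumes "0 < i" "i < m"
  shows "alternating s t i \<noteq> alternating t s i"
proof
  assume "alternating s t i = alternating t s i"
  then have "(True, i) = (False, i)"
    using assms by (intro inj_onD[OF alternating_index_inj]) simp_all
  then show False by simp
qed

lemma alternating_index_unique:
  assumes "y \<in> {alternating s t i, alternating t s i}" "y \<in> {alternating s t j, alternating t s j}"
    and "i \<le> m" "j \<le> m"
  shows "i = j"
proof -
  let ?I = "{True} \<times> {..m} \<union> {False} \<times> {0<..<m}"
  have label: "\<exists>c. (c, i) \<in> ?I \<and> (if c then alternating s t i else alternating t s i) = y"
    if y: "y \<in> {alternating s t i, alternating t s i}" and "i \<le> m" for i
  proof (cases "y = alternating s t i")
    case True
    then show ?thesis using that(2) by (intro exI[of _ True]) simp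
  next
    case False
    then have y': "y = alternating t s i" using y by simp
    with False have "i \<noteq> 0" "i \<noteq> m" using alternating_top by (metis alternating.simps(1))+
    then show ?thesis using y' that(2) by (intro exI[of _ False]) simp
  qed
  obtain c d where "(c, i) \<in> ?I" "(if c then alternating s t i else alternating t s i) = y"
    and "(d, j) \<in> ?I" "(if d then alternating s t j else alternating t s j) = y"
    using label[OF assms(1,3)] label[OF assms(2,4)] by blast
  then have "(c, i) = (d, j)"
    by (intro inj_onD[OF alternating_index_inj]) simp_all
  then show ?thesis by simp
qed

abbreviation len :: "'a \<Rightarrow> nat" where
  "len \<equiv> word_length W {s, t}"

lemma word_prod_short:
  "set ws \<subseteq> {s, t} \<Longrightarrow> word_prod W ws \<in> short_elements (min (length ws) m)"
proof (induction ws)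
  case Nil
  then show ?case by (simp add: word_prod_def one_short)
next
  case (Cons a ws)
  then have "a \<otimes> word_prod W ws \<in> short_elements (min (Suc (min (length ws) m)) m)"
    by (intro generator_mult_short) auto
  moreover have "min (Suc (min (length ws) m)) m = min (length (a # ws)) m" by auto
  ultimately show ?case by (simp add: word_prod_def)
qed

lemma alternating_word:
  assumes "a \<in> {s, t}" "b \<in> {s, t}"
  shows "\<exists>ws. set ws \<subseteq> {s, t} \<and> length ws = k \<and> word_prod W ws = alternating a b k"
  using assms
proof (induction k arbitrary: a b)
  case 0
  then show ?case by (simp add: word_prod_def)
next
  case (Suc k)
  then obtain ws where "set ws \<subseteq> {s, t}" "length ws = k" "word_prod W ws = alternating b a k"
    by metis
  then show ?case using Suc.prems by (intro exI[of _ "a # ws"]) (auto simp: word_prod_def)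
qed

text \<open>
  A shorter word would be an alternating word of smaller length, against uniqueness.
\<close>

lemma length_alternating:
  assumes "i \<le> m" "y \<in> {alternating s t i, alternating t s i}"
  shows "len y = i"
  unfolding word_length_def
proof (rule Least_equality)
  show "\<exists>ws. set ws \<subseteq> {s, t} \<and> length ws = i \<and> word_prod W ws = y"
    using assms(2) alternating_word[of s t i] alternating_word[of t s i] by auto
next
  fix k assume "\<exists>ws. set ws \<subseteq> {s, t} \<and> length ws = k \<and> word_prod W ws = y"
  then have "y \<in> short_elements (min k m)" using word_prod_short by auto
  then obtain j where "j \<le> k" "j \<le> m" "y \<in> {alternating s t j, alternating t s j}"
    unfolding short_elements_def by auto
  then show "i \<le> k" using alternating_index_unique[OF assms(2)] assms(1) by blast
qed

lemma length_cases:
  assumes "y \<in> carrier W"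
  shows "len y \<le> m" "y = alternating s t (len y) \<or> y = alternating t s (len y)"
proof -
  obtain i where "i \<le> m" "y \<in> {alternating s t i, alternating t s i}"
    using assms unfolding carrier_short short_elements_def by auto
  moreover from this have "len y = i" by (rule length_alternating)
  ultimately show "len y \<le> m" "y = alternating s t (len y) \<or> y = alternating t s (len y)"
    by auto
qed

lemma length_class:
  assumes "i \<le> m"
  shows "{y \<in> carrier W. len y = i} = {alternating s t i, alternating t s i}"
  using length_cases(2) length_alternating[OF assms] alternating_closed by auto

section \<open>The Bruhat order is the length order\<close>

lemma alternating_Suc_right:
  assumes "a \<in> {s, t}" "b \<in> {s, t}"
  shows "\<exists>u\<in>{s, t}. alternating a b (Suc i) = alternating a b i \<otimes> u"
  using assms
proof (induction i arbitrary: a b)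
  case 0
  then show ?case by (intro bexI[of _ a]) (auto simp: generator_closed)
next
  case (Suc i)
  then obtain u where u: "u \<in> {s, t}" "alternating b a (Suc i) = alternating b a i \<otimes> u" by metis
  have "alternating a b (Suc (Suc i)) = alternating a b (Suc i) \<otimes> u"
    using Suc.prems u by (simp add: m_assoc generator_closed alternating_closed)
  then show ?case using u(1) by blast
qed

text \<open>
  Elements of consecutive lengths either start with the same letter, and then \<open>y = x u\<close> with a
  generator \<open>u\<close> and \<open>x = (x u inv x) y\<close>, or with different letters, and then \<open>y = b x\<close> with a
  generator \<open>b\<close>.
\<close>

lemma bruhat_step_consecutive:
  assumes x: "x \<in> carrier W" and y: "y \<in> carrier W" and len: "len y = Suc (len x)"
  shows "(x, y) \<in> bruhat_step W {s, t}"
proof -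
  obtain a b where ab: "{a, b} = {s, t}" "x = alternating a b (len x)"
    using length_cases(2)[OF x] by (metis insert_commute)
  have gens: "a \<in> {s, t}" "b \<in> {s, t}" using ab(1) by auto
  have "\<exists>r\<in>reflections W {s, t}. x = r \<otimes> y"
  proof (cases "y = alternating a b (len y)")
    case True
    obtain u where u: "u \<in> {s, t}" "alternating a b (Suc (len x)) = alternating a b (len x) \<otimes> u"
      using alternating_Suc_right[OF gens] by blast
    then have y_eq: "y = x \<otimes> u" using True ab(2) len by metis
    have "inv x \<otimes> (x \<otimes> u) = u"
      using x generator_closed[OF u(1)] by (simp add: m_assoc[symmetric])
    then have "x \<otimes> u \<otimes> inv x \<otimes> (x \<otimes> u) = x"
      using x generator_closed[OF u(1)] generator_square[OF u(1)] by (simp add: m_assoc)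
    moreover have "x \<otimes> u \<otimes> inv x \<in> reflections W {s, t}"
      unfolding reflections_def using x u(1) by blast
    ultimately show ?thesis using y_eq by metis
  next
    case False
    then have "y = alternating b a (len y)"
      using length_cases(2)[OF y] ab(1) by (auto simp: doubleton_eq_iff)
    then have "y = b \<otimes> x" using ab(2) len by (metis alternating.simps(2))
    then have "x = b \<otimes> y" using generator_cancel[OF gens(2) x] by simp
    moreover have "\<one> \<otimes> b \<otimes> inv \<one> \<in> reflections W {s, t}"
      unfolding reflections_def using gens(2) by blast
    then have "b \<in> reflections W {s, t}" using generator_closed[OF gens(2)] by simp
    ultimately show ?thesis by blast
  qed
  then show ?thesis using y len unfolding bruhat_step_def by fastforce
qed

lemma bruhat_less_length: "(x, y) \<in> bruhat_less W {s, t} \<Longrightarrow> len x < len y"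
  unfolding bruhat_less_def by (induction rule: trancl_induct) (auto simp: bruhat_step_def)

lemma bruhat_less_iff:
  assumes "x \<in> carrier W" "y \<in> carrier W"
  shows "(x, y) \<in> bruhat_less W {s, t} \<longleftrightarrow> len x < len y"
proof
  have "(x, y) \<in> bruhat_less W {s, t}" if "y \<in> carrier W" "len y = Suc (len x + k)" for k y
    using that
  proof (induction k arbitrary: y)
    case 0
    then show ?case
      using bruhat_step_consecutive[OF assms(1)] by (auto simp: bruhat_less_def)
  next
    case (Suc k)
    define z where "z = alternating s t (Suc (len x + k))"
    have z: "z \<in> carrier W" by (simp add: z_def alternating_closed del: alternating.simps)
    have "Suc (len x + k) \<le> m" using length_cases(1)[OF Suc.prems(1)] Suc.prems(2) by simp
    then have "len z = Suc (len x + k)" by (rule length_alternating) (simp add: z_def)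
    then have "(x, z) \<in> bruhat_less W {s, t}" "(z, y) \<in> bruhat_step W {s, t}"
      using Suc z bruhat_step_consecutive by auto
    then show ?case unfolding bruhat_less_def by (rule trancl_into_trancl)
  qed
  then show "len x < len y \<Longrightarrow> (x, y) \<in> bruhat_less W {s, t}"
    using assms(2) less_iff_Suc_add by metis
qed (rule bruhat_less_length)

lemma bruhat_covers_iff:
  assumes x: "x \<in> carrier W" and y: "y \<in> carrier W"
  shows "bruhat_covers W {s, t} y x \<longleftrightarrow> len y = Suc (len x)"
proof
  assume cov: "bruhat_covers W {s, t} y x"
  then have less: "len x < len y" by (simp add: bruhat_covers_def bruhat_less_iff x y)
  show "len y = Suc (len x)"
  proof (rule ccontr)
    assume "len y \<noteq> Suc (len x)"
    then have gap: "Suc (len x) < len y" using less by simp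
    define z where "z = alternating s t (Suc (len x))"
    have z: "z \<in> carrier W" by (simp add: z_def alternating_closed del: alternating.simps)
    have "len z = Suc (len x)"
      using gap length_cases(1)[OF y] by (intro length_alternating) (auto simp: z_def)
    then show False using cov gap bruhat_less_iff[OF x z] bruhat_less_iff[OF z y]
      by (auto simp: bruhat_covers_def)
  qed
next
  assume len: "len y = Suc (len x)"
  then have "\<not> (\<exists>z. (x, z) \<in> bruhat_less W {s, t} \<and> (z, y) \<in> bruhat_less W {s, t})"
    by (auto dest!: bruhat_less_length)
  then show "bruhat_covers W {s, t} y x"
    using len by (simp add: bruhat_covers_def bruhat_less_iff x y)
qed

lemma bruhat_graph_levels:
  "two_element_levels (bruhat_graph W {s, t}) (\<lambda>v. int (len v)) (int m)"
proof
  fix x assume "x \<in> verts (bruhat_graph W {s, t})"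
  then have x: "x \<in> carrier W" by (simp add: bruhat_graph_def)
  then show "0 \<le> int (len x) \<and> int (len x) \<le> int m" using length_cases(1) by simp
  have "{x, v} \<in> edges (bruhat_graph W {s, t}) \<longleftrightarrow> \<bar>int (len v) - int (len x)\<bar> = 1"
    if v: "v \<in> carrier W" for v
  proof -
    have "{x, v} \<in> edges (bruhat_graph W {s, t}) \<longleftrightarrow>
        bruhat_covers W {s, t} v x \<or> bruhat_covers W {s, t} x v"
      unfolding bruhat_graph_def using x v by (auto simp: doubleton_eq_iff)
    also have "\<dots> \<longleftrightarrow> len v = Suc (len x) \<or> len x = Suc (len v)"
      using x v by (simp add: bruhat_covers_iff)
    finally show ?thesis by auto
  qed
  then show "neighbours (bruhat_graph W {s, t}) x =
      {v \<in> verts (bruhat_graph W {s, t}). \<bar>int (len v) - int (len x)\<bar> = 1}"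
    unfolding neighbours_def by (auto simp: bruhat_graph_def)
next
  show "card {v \<in> verts (bruhat_graph W {s, t}). int (len v) = 0} = 1"
    using length_class[of 0] by (simp add: bruhat_graph_def)
  show "card {v \<in> verts (bruhat_graph W {s, t}). int (len v) = int m} = 1"
    using length_class[of m] alternating_top by (simp add: bruhat_graph_def)
next
  fix i :: int assume i: "0 < i" "i < int m"
  then have "{v \<in> carrier W. int (len v) = i} = {v \<in> carrier W. len v = nat i}" by auto
  then show "card {v \<in> verts (bruhat_graph W {s, t}). int (len v) = i} = 2"
    using i length_class[of "nat i"] alternating_distinct[of "nat i"]
    by (simp add: bruhat_graph_def)
qed

end

theorem proposition18:
  fixes W :: "('a, 'b) monoid_scheme" and s t :: 'a and n :: nat
  assumes "dihedral_system W s t n"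
  shows "(n = 3 \<longrightarrow> Ric (bruhat_graph W {s, t}) = ereal ((21 - sqrt 33) / 12)) \<and>
    (n = 4 \<longrightarrow> Ric (bruhat_graph W {s, t}) = ereal (1 / 2)) \<and>
    (n = 5 \<longrightarrow> Ric (bruhat_graph W {s, t}) = ereal ((5 - sqrt 17) / 4)) \<and>
    (n > 5 \<longrightarrow> Ric (bruhat_graph W {s, t}) = 0)"
proof -
  have levels: "two_element_levels (bruhat_graph W {s, t})
      (\<lambda>v. int (word_length W {s, t} v)) (int n)" if "n > 0"
    using assms that
    by (intro finite_dihedral_system.bruhat_graph_levels finite_dihedral_system.intro
        finite_dihedral_system_axioms.intro)
  show ?thesis
    using two_element_levels.Ric_three[OF levels] two_element_levels.Ric_four[OF levels]
      two_element_levels.Ric_five[OF levels] two_element_levels.Ric_large[OF levels]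
    by auto
qed

end
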